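(* Let $n$ be a positive integer. Let $\mathcal{G}$ be a fractional $L$-intersecting family of subsets of $[n]$, where $L=\{\frac{a}{b}\}$ with $\frac{a}{b} \in [0, 1)$ an irreducible fraction and $b$ a prime. Then $|\mathcal{G}| \leq (b-1)(n+1)\lceil \frac{\ln n}{\ln b} \rceil + 1$.
   Context: $[n]=\{1,\ldots,n\}$. For a set $L$ of irreducible fractions in $[0,1)$, a family $\mathcal{F}=\{A_1,\ldots,A_m\}$ of (distinct) subsets of $[n]$ is a fractional $L$-intersecting family if for every distinct $i,j\in[m]$ there exists $\frac{a}{b}\in L$ such that $|A_i\cap A_j|\in\{\frac{a}{b}|A_i|,\frac{a}{b}|A_j|\}$.
   Formalization: The case n = 1 with G = {∅, {1}} is excluded: this family is fractional L-intersecting with two members (0 = (a/b)·|∅|), while the stated bound equals 1 since ln 1 = 0, so the claim fails there; all other cases are kept. *)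

theory Defs
  imports Complex_Main "HOL-Computational_Algebra.Primes"
begin

text \<open>
  Irreducible fractions in \<open>[0, 1)\<close> correspond one-to-one to rational numbers in \<open>[0, 1)\<close>, so
  \<open>L\<close> is a set of rationals. A family of distinct subsets of \<open>{1, \<dots>, n}\<close> is a set of sets.
\<close>

definition fractional_intersecting_family :: "rat set \<Rightarrow> nat \<Rightarrow> nat set set \<Rightarrow> bool" where
  "fractional_intersecting_family L n F \<longleftrightarrow>
     L \<subseteq> {0..<1} \<and> F \<subseteq> Pow {1..n} \<and>
     (\<forall>A\<in>F. \<forall>B\<in>F. A \<noteq> B \<longrightarrow>
        (\<exists>q\<in>L. of_nat (card (A \<inter> B)) \<in> {q * of_nat (card A), q * of_nat (card B)}))"

end

theory Submission
  imports Defs "HOL-Number_Theory.Cong"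
begin

text \<open>
  If \<open>|A \<inter> B|\<close> is \<open>a/b\<close> times \<open>|A|\<close> or \<open>|B|\<close>, then \<open>b\<close> divides one of the two sizes, so at most one
  member of the family has size not divisible by \<open>b\<close>. Sort the nonempty others by the exponent \<open>k\<close>
  of \<open>b\<close> in \<open>|A| = b\<^sup>k l\<close> and by the residue \<open>r\<close> of \<open>l\<close> modulo \<open>b\<close>. After division by \<open>b\<^sup>k\<^sup>-\<^sup>1\<close>, the
  sizes in one class vanish modulo \<open>b\<close>, while the pairwise intersections are congruent to the unit
  \<open>a r\<close>. If a class had \<open>n + 2\<close> members, then their incidence vectors, extended by a coordinate \<open>1\<close>,
  would satisfy an integer relation whose coefficients are not all divisible by \<open>b\<close>; pairing it
  with each incidence vector, and using that the coefficients sum to \<open>0\<close>, shows that \<open>b\<close> divides all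
  of them. Hence each class has at most \<open>n + 1\<close> members. For \<open>k = \<lceil>log\<^sub>b n\<rceil>\<close> only \<open>{1..n}\<close> itself can
  occur, and the slack so gained pays for the empty set.
\<close>

text \<open>Fraction-free Gaussian elimination, one equation at a time: cross-multiplying with a
  pivot \<open>p\<close> clears the equation at \<open>x\<close> without leaving the integers, and
  costs one index and one equation.\<close>

lemma ex_nontrivial_int_relation:
  fixes f :: "'i \<Rightarrow> 'x \<Rightarrow> int"
  assumes "finite X" "finite I" "card X < card I"
  shows "\<exists>u. (\<exists>i\<in>I. u i \<noteq> 0) \<and> (\<forall>x\<in>X. (\<Sum>i\<in>I. u i * f i x) = 0)"
  using assms
proof (induction X arbitrary: I f rule: finite_induct)
  case empty
  then have "I \<noteq> {}" by auto
  then show ?case by (intro exI[of _ "\<lambda>_. 1"]) auto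
next
  case (insert x X)
  show ?case
  proof (cases "\<forall>i\<in>I. f i x = 0")
    case True
    have "card X < card I" using insert by auto
    from insert.IH[OF insert.prems(1) this, of f] True show ?thesis by force
  next
    case False
    then obtain p where p: "p \<in> I" "f p x \<noteq> 0" by auto
    define g where "g i y = f p x * f i y - f i x * f p y" for i y
    have "finite (I - {p})" "card X < card (I - {p})"
      using insert p by auto
    from insert.IH[OF this, of g] obtain v where
      v: "\<exists>i\<in>I - {p}. v i \<noteq> 0" "\<forall>y\<in>X. (\<Sum>i\<in>I - {p}. v i * g i y) = 0"
      by blast
    \<comment> \<open>The value at \<open>p\<close> makes the relation for \<open>f\<close> agree
      with that for \<open>g\<close> at every \<open>y\<close>; at \<open>x\<close> it then holds
      because \<open>g i x = 0\<close>.\<close>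
    define u where "u i = (if i = p then - (\<Sum>i\<in>I - {p}. v i * f i x) else f p x * v i)" for i
    have "(\<Sum>i\<in>I. u i * f i y) = (\<Sum>i\<in>I - {p}. v i * g i y)" for y
    proof -
      have "(\<Sum>i\<in>I. u i * f i y) = u p * f p y + (\<Sum>i\<in>I - {p}. u i * f i y)"
        using p insert.prems by (simp add: sum.remove)
      also have "(\<Sum>i\<in>I - {p}. u i * f i y) = (\<Sum>i\<in>I - {p}. f p x * v i * f i y)"
        by (rule sum.cong) (auto simp: u_def)
      also have "u p * f p y + \<dots> = (\<Sum>i\<in>I - {p}. v i * g i y)"
        by (simp add: u_def g_def right_diff_distrib sum_subtractf
            sum_distrib_left sum_distrib_right ac_simps)
      finally show ?thesis .
    qed
    moreover have "(\<Sum>i\<in>I - {p}. v i * g i x) = 0"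
      by (simp add: g_def)
    moreover have "\<exists>i\<in>I. u i \<noteq> 0" using v(1) p by (auto simp: u_def)
    ultimately show ?thesis using v(2) by (intro exI[of _ u]) auto
  qed
qed

text \<open>Divide a nontrivial relation by the gcd \<open>d\<close> of its coefficients: if
  \<open>p\<close> divided every quotient, \<open>d * p\<close> would divide \<open>d\<close>. This
  keeps the relation nonzero after reduction modulo \<open>p\<close>.\<close>

lemma ex_primitive_int_relation:
  fixes f :: "'i \<Rightarrow> 'x \<Rightarrow> int"
  assumes "finite X" "finite I" "card X < card I" "\<not> is_unit p"
  shows "\<exists>u. (\<exists>i\<in>I. \<not> p dvd u i) \<and> (\<forall>x\<in>X. (\<Sum>i\<in>I. u i * f i x) = 0)"
proof -
  obtain u where u: "\<exists>i\<in>I. u i \<noteq> 0" "\<forall>x\<in>X. (\<Sum>i\<in>I. u i * f i x) = 0"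
    using ex_nontrivial_int_relation[OF assms(1-3)] by blast
  define d where "d = Gcd (u ` I)"
  have d0: "d \<noteq> 0" using u(1) by (auto simp: d_def)
  define w where "w i = u i div d" for i
  have w: "u i = d * w i" if "i \<in> I" for i
    using that by (simp add: w_def d_def)
  have "\<exists>i\<in>I. \<not> p dvd w i"
  proof (rule ccontr)
    assume "\<not> ?thesis"
    then have "d * p dvd Gcd (u ` I)"
      by (auto intro!: Gcd_greatest simp: w mult_dvd_mono)
    then have "d * p dvd d * 1" by (simp add: d_def)
    then show False using d0 assms(4) by (simp only: dvd_mult_cancel_left) simp
  qed
  moreover have "(\<Sum>i\<in>I. w i * f i x) = 0" if "x \<in> X" for x
  proof -
    have "d * (\<Sum>i\<in>I. w i * f i x) = (\<Sum>i\<in>I. u i * f i x)"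
      by (simp add: sum_distrib_left w mult.assoc)
    then show ?thesis using u(2) that d0 by simp
  qed
  ultimately show ?thesis by blast
qed

text \<open>The relation is kept over the integers so that \<open>d\<close> can be cancelled before
  reducing modulo \<open>p\<close>. The reduced Gram matrix is \<open>c\<close> off the diagonal and
  0 on it, so for coefficients of sum 0 its row at \<open>A\<close> yields
  \<open>- c * u A\<close>.\<close>

lemma card_family_le_if_intersections_cong:
  fixes p d c n :: nat
  assumes p: "prime p" and d: "d > 0" and c: "\<not> p dvd c"
    and F: "F \<subseteq> Pow {1..n}"
    and diag: "\<And>A. A \<in> F \<Longrightarrow> p * d dvd card A"
    and inter: "\<And>A B. A \<in> F \<Longrightarrow> B \<in> F \<Longrightarrow> A \<noteq> B \<Longrightarrow> \<exists>t. card (A \<inter> B) = d * t \<and> [t = c] (mod p)"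
  shows "card F \<le> n + 1"
proof (rule ccontr)
  assume "\<not> ?thesis"
  then have less: "card {0..n} < card F" by simp
  have finF: "finite F" using F by (rule finite_subset) simp
  have "\<not> is_unit (int p)" using p by (auto simp: prime_nat_iff)
  \<comment> \<open>The extra point 0 lies in every extended set, so its equation says that the
    coefficients sum to 0.\<close>
  from ex_primitive_int_relation[OF _ finF less this, of "\<lambda>A x. of_bool (x \<in> insert 0 A)"]
  obtain u where ndvd: "\<exists>A\<in>F. \<not> int p dvd u A"
    and rel: "\<forall>x\<in>{0..n}. (\<Sum>A\<in>F. u A * of_bool (x \<in> insert 0 A)) = 0" by auto
  have sum0: "(\<Sum>A\<in>F. u A) = 0" using bspec[OF rel, of 0] by simp
  have "int p dvd u A" if A: "A \<in> F" for A
  proof -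
    have subA: "A \<subseteq> {1..n}" using A F by auto
    then have finA: "finite A" by (rule finite_subset) simp
    have "\<exists>t. int (card (A \<inter> B)) = int d * t \<and> [t = (if B = A then 0 else int c)] (mod int p)"
      if B: "B \<in> F" for B
    proof (cases "B = A")
      case True
      from diag[OF A] obtain s where "card A = d * (p * s)"
        by (metis dvdE mult.assoc mult.commute)
      then show ?thesis using True
        by (intro exI[of _ "int (p * s)"]) (auto simp: cong_def)
    next
      case False
      with inter[OF A B] obtain t where "card (A \<inter> B) = d * t" "[t = c] (mod p)" by auto
      then show ?thesis using False
        by (intro exI[of _ "int t"]) (auto simp: cong_int_iff)
    qed
    then obtain t where t: "\<And>B. B \<in> F \<Longrightarrow> int (card (A \<inter> B)) = int d * t B"
        "\<And>B. B \<in> F \<Longrightarrow> [t B = (if B = A then 0 else int c)] (mod int p)"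
      by metis
    have "int d * (\<Sum>B\<in>F. u B * t B) = (\<Sum>B\<in>F. u B * int (card (A \<inter> B)))"
      by (simp add: sum_distrib_left t(1) algebra_simps)
    \<comment> \<open>Counting \<open>A \<inter> B\<close> pointwise turns the sum into the
      equations of the relation at the points of \<open>A\<close>.\<close>
    also have "\<dots> = (\<Sum>B\<in>F. \<Sum>x\<in>A. u B * of_bool (x \<in> B))"
      using finA by (simp add: sum_distrib_left[symmetric] of_bool_def sum.If_cases Int_def)
    also have "\<dots> = (\<Sum>x\<in>A. \<Sum>B\<in>F. u B * of_bool (x \<in> B))"
      by (rule sum.swap)
    also have "\<dots> = 0"
    proof (rule sum.neutral, rule ballI)
      fix x assume "x \<in> A"
      then have "x \<in> {0..n}" "x \<noteq> 0" using subA by auto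
      then show "(\<Sum>B\<in>F. u B * of_bool (x \<in> B)) = 0" using rel by fastforce
    qed
    finally have "(\<Sum>B\<in>F. u B * t B) = 0" using d by simp
    moreover have "[(\<Sum>B\<in>F. u B * t B) = (\<Sum>B\<in>F. u B * (if B = A then 0 else int c))] (mod int p)"
      by (intro cong_sum cong_mult cong_refl t(2))
    moreover have "(\<Sum>B\<in>F. u B * (if B = A then 0 else int c)) = - (int c * u A)"
    proof -
      have "(\<Sum>B\<in>F. u B * (if B = A then 0 else int c))
          = (\<Sum>B\<in>F. u B * int c - (if B = A then u B * int c else 0))"
        by (rule sum.cong) auto
      also have "\<dots> = (\<Sum>B\<in>F. u B) * int c - u A * int c"
        using finF A by (simp add: sum_subtractf sum_distrib_right)
      finally show ?thesis using sum0 by simp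
    qed
    ultimately have "int p dvd int c * u A"
      by (metis cong_0_iff cong_sym dvd_minus_iff)
    then show ?thesis using p c by (simp add: prime_dvd_mult_iff)
  qed
  then show False using ndvd by blast
qed

lemma fractional_intersecting_familyD:
  fixes a b :: nat
  assumes "fractional_intersecting_family {of_nat a / of_nat b} n G" "b > 0"
    "A \<in> G" "B \<in> G" "A \<noteq> B"
  shows "b * card (A \<inter> B) = a * card A \<or> b * card (A \<inter> B) = a * card B"
proof -
  have *: "b * x = a * y" if "(of_nat x :: rat) = of_nat a / of_nat b * of_nat y" for x y
  proof -
    have "(of_nat (b * x) :: rat) = of_nat (a * y)"
      using that assms(2) by (simp add: field_simps)
    then show ?thesis by (simp only: of_nat_eq_iff)
  qed
  have "of_nat (card (A \<inter> B)) = (of_nat a / of_nat b * of_nat (card A) :: rat)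
      \<or> of_nat (card (A \<inter> B)) = (of_nat a / of_nat b * of_nat (card B) :: rat)"
    using assms unfolding fractional_intersecting_family_def by (simp only: bex_simps) blast
  then show ?thesis by (elim disjE) (simp_all only: * simp_thms)
qed

text \<open>The family \<open>Pow {1}\<close> for \<open>n = 1\<close> is a genuine exception: the
  empty set meets {1} in 0 elements, a fraction of its own size 0, so the family is admissible with
  two members, while the logarithm vanishes and the bound is 1.\<close>

theorem theorem2:
  fixes n a b :: nat and G :: "nat set set"
  assumes "n \<ge> 1"
    and "prime b"
    and "coprime a b"
    and "of_nat a / of_nat b \<in> {0..<1 :: rat}"
    and "fractional_intersecting_family {of_nat a / of_nat b} n G"
    and "\<not> (n = 1 \<and> G = Pow {1})"
  shows "real (card G) \<le> (real b - 1) * (real n + 1) * of_int \<lceil>ln (real n) / ln (real b)\<rceil> + 1"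
proof (cases "n = 1")
  case True
  have "G \<subseteq> Pow {1}" using assms(5) True by (simp add: fractional_intersecting_family_def)
  then have "card G < card (Pow {1::nat})"
    using assms(6) True by (intro psubset_card_mono) auto
  then show ?thesis using True by (simp add: card_Pow)
next
  case False
  then have n: "n \<ge> 2" using assms(1) by simp
  have b: "b \<ge> 2" using assms(2) by (rule prime_ge_2_nat)
  have sub: "G \<subseteq> Pow {1..n}" using assms(5) by (simp add: fractional_intersecting_family_def)
  have finG: "finite G" using sub by (rule finite_subset) simp
  note meet = fractional_intersecting_familyD[OF assms(5)]
  have nba: "\<not> b dvd a"
    using assms(2,3) by (metis coprime_absorb_right coprime_commute not_prime_unit)
  define c where "c = nat \<lceil>log (real b) (real n)\<rceil>"
  have log_pos: "log (real b) (real n) > 0" using b n by simp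
  have c1: "c \<ge> 1" using log_pos unfolding c_def by linarith
  have ceil: "\<lceil>ln (real n) / ln (real b)\<rceil> = int c"
    using log_pos by (simp add: c_def log_def)
  have nle: "n \<le> b ^ c"
  proof -
    have "log (real b) (real n) \<le> real c" using log_pos unfolding c_def by linarith
    then have "real n \<le> real b powr real c" using b n by (simp add: log_le_iff)
    also have "\<dots> = real (b ^ c)" using b by (simp add: powr_realpow)
    finally show ?thesis by (simp only: of_nat_le_iff)
  qed
  define N where "N = {A \<in> G. \<not> b dvd card A}"
  \<comment> \<open>For \<open>r\<close> in \<open>{1..<b}\<close> the cofactor \<open>l\<close> is
    prime to \<open>b\<close>, so \<open>k\<close> is the exact exponent of \<open>b\<close> in the
    size.\<close>
  define F where "F k r = {A \<in> G. \<exists>l. card A = b ^ k * l \<and> [l = r] (mod b)}" for k r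
  have cardN: "card N \<le> 1"
  proof -
    have "A = B" if "A \<in> N" "B \<in> N" for A B
    proof (rule ccontr)
      assume "A \<noteq> B"
      then have "b * card (A \<inter> B) = a * card A \<or> b * card (A \<inter> B) = a * card B"
        using meet[of A B] that b by (simp add: N_def)
      then have "b dvd a * card A \<or> b dvd a * card B" by (metis dvd_triv_left)
      then show False using that nba assms(2) by (auto simp: N_def prime_dvd_mult_iff)
    qed
    moreover have "finite N" using finG by (simp add: N_def)
    ultimately show ?thesis by (simp add: card_le_Suc0_iff_eq)
  qed
  have cardF: "card (F k r) \<le> n + 1" if k: "k \<in> {1..<c}" and r: "r \<in> {1..<b}" for k r
  proof (rule card_family_le_if_intersections_cong[where p = b and d = "b ^ (k - 1)" and c = "a * r"])
    have bk: "b ^ k = b * b ^ (k - 1)" using k by (cases k) auto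
    show "prime b" by fact
    show "b ^ (k - 1) > 0" using b by simp
    show "\<not> b dvd a * r" using r nba assms(2) by (auto simp: prime_dvd_mult_iff dest: dvd_imp_le)
    show "F k r \<subseteq> Pow {1..n}" using sub by (auto simp: F_def)
    show "b * b ^ (k - 1) dvd card A" if "A \<in> F k r" for A
      using that unfolding F_def bk[symmetric] by auto
    fix A B assume AB: "A \<in> F k r" "B \<in> F k r" "A \<noteq> B"
    have "b * card (A \<inter> B) = a * card A \<or> b * card (A \<inter> B) = a * card B"
      using AB meet[of A B] b by (simp add: F_def)
    moreover obtain s t where "card A = b ^ k * s" "[s = r] (mod b)"
        "card B = b ^ k * t" "[t = r] (mod b)"
      using AB unfolding F_def by blast
    \<comment> \<open>Whichever of the two sizes the intersection is a fraction of, its cofactor is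
      \<open>r\<close> modulo \<open>b\<close>.\<close>
    ultimately have "\<exists>l. b * card (A \<inter> B) = a * (b ^ k * l) \<and> [l = r] (mod b)"
      by metis
    then obtain l where l: "b * card (A \<inter> B) = a * (b ^ k * l)" "[l = r] (mod b)" by blast
    \<comment> \<open>The denominator absorbs one factor of \<open>b ^ k\<close>, hence the exponent
      \<open>k - 1\<close>.\<close>
    have "b * card (A \<inter> B) = b * (b ^ (k - 1) * (a * l))"
      using l(1) by (simp add: bk ac_simps)
    then have "card (A \<inter> B) = b ^ (k - 1) * (a * l)" using b by simp
    moreover have "[a * l = a * r] (mod b)" using l(2) by (rule cong_scalar_left)
    ultimately show "\<exists>t. card (A \<inter> B) = b ^ (k - 1) * t \<and> [t = a * r] (mod b)" by blast
  qed
  define U where "U = (\<Union>k\<in>{1..<c}. \<Union>r\<in>{1..<b}. F k r)"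
  have cover: "G \<subseteq> {{}, {1..n}} \<union> N \<union> U"
  proof
    fix A assume A: "A \<in> G"
    then have subA: "A \<subseteq> {1..n}" using sub by auto
    then have finA: "finite A" by (rule finite_subset) simp
    have cardA: "card A \<le> n" using card_mono[OF _ subA] by simp
    show "A \<in> {{}, {1..n}} \<union> N \<union> U"
    proof (cases "A = {} \<or> A \<in> N")
      case False
      then have dvd: "b dvd card A" and nz: "card A \<noteq> 0" using A finA by (auto simp: N_def)
      define k where "k = multiplicity b (card A)"
      obtain l where l: "card A = b ^ k * l" "\<not> b dvd l"
        using multiplicity_decompose'[of "card A" b] nz assms(2) unfolding k_def
        by (metis not_prime_unit)
      have k1: "k \<ge> 1" using dvd l by (cases k) auto
      have "b ^ k \<le> card A" using l nz by simp
      then have "b ^ k \<le> b ^ c" using cardA nle by linarith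
      then have kc: "k \<le> c" using b by simp
      show ?thesis
      proof (cases "k = c")
        case True
        \<comment> \<open>The chain \<open>b ^ c\<close> \<le> \<open>card A\<close> \<le>
          \<open>n\<close> \<le> \<open>b ^ c\<close> collapses.\<close>
        then have "card A = n" using \<open>b ^ k \<le> card A\<close> cardA nle by simp
        then have "A = {1..n}" using subA by (intro card_subset_eq) auto
        then show ?thesis by simp
      next
        case False
        have "l mod b \<in> {1..<b}" using l(2) b by (auto simp: dvd_eq_mod_eq_0 Suc_le_eq)
        moreover have "A \<in> F k (l mod b)" using A l(1) by (auto simp: F_def cong_def)
        ultimately show ?thesis using kc k1 False unfolding U_def by fastforce
      qed
    qed auto
  qed
  have "card U \<le> (\<Sum>k\<in>{1..<c}. \<Sum>r\<in>{1..<b}. card (F k r))"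
    unfolding U_def by (intro order.trans[OF card_UN_le] sum_mono) auto
  also have "\<dots> \<le> (\<Sum>k\<in>{1..<c}. \<Sum>r\<in>{1..<b}. n + 1)"
    by (intro sum_mono cardF)
  also have "\<dots> = (c - 1) * ((b - 1) * (n + 1))" by simp
  finally have cardU: "card U \<le> (c - 1) * ((b - 1) * (n + 1))" .
  have "finite ({{}, {1..n}} \<union> N \<union> U)"
    using finG by (auto simp: N_def U_def F_def)
  then have "card G \<le> card ({{}, {1..n}} \<union> N \<union> U)" using cover by (rule card_mono)
  also have "\<dots> \<le> card {{}, {1..n}} + card N + card U"
    by (meson card_Un_le add_mono order.refl order.trans)
  also have "card {{}, {1..n}} \<le> 2" by (simp add: card_insert_if)
  finally have "card G \<le> 3 + (c - 1) * ((b - 1) * (n + 1))" using cardN cardU by linarith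
  also have "\<dots> \<le> 1 + (b - 1) * (n + 1) + (c - 1) * ((b - 1) * (n + 1))"
  proof -
    have *: "3 + y \<le> 1 + x + y" if "1 * (1 + 1) \<le> x" for x y :: nat using that by simp
    show ?thesis using b n by (intro * mult_mono) auto
  qed
  also have "\<dots> = (b - 1) * (n + 1) * c + 1" using c1 by (cases c) auto
  finally have "real (card G) \<le> real ((b - 1) * (n + 1) * c + 1)" by (simp only: of_nat_le_iff)
  moreover have "real (b - 1) = real b - 1" using b by (simp add: of_nat_diff)
  ultimately show ?thesis by (simp only: ceil of_nat_mult of_nat_add of_nat_1 of_int_of_nat_eq)
qed

end
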